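(* For all positive integers $k$ and all barriers $B$, $\mathsf{RRT}^B_k\leq_{\mathrm{sW}}\mathsf{RT}^B_k$.
   Context: $\mathbb{N}$ is the set of natural numbers (including $0$). Subsets of $\mathbb{N}$ are identified with their strictly increasing enumerations; $s\sqsubset Y$ means that $s$ is a proper initial segment of $Y$ as a sequence; $\subset$ is strict set inclusion. A set $B$ of finite subsets of $\mathbb{N}$ is a barrier on an infinite set $X\subseteq\mathbb{N}$ if: (1) $\bigcup B=X$; (2) for all $s,t\in B$, $s\not\subset t$; (3) for every infinite $Y\subseteq X$ there is $s\in B$ with $s\sqsubset Y$. The set $X=\bigcup B$ is the base of $B$. For infinite $Y\subseteq X$, $B\vert Y=\{s\in B: s\subseteq Y\}$ (this is a barrier on $Y$, and every barrier $B'\subseteq B$ has this form). A function $f:B\to\mathbb{N}$ is $k$-bounded if $|f^{-1}(x)|\le k$ for every $x\in\mathbb{N}$. $\mathsf{RRT}^B_k$ is the problem whose instances are the $k$-bounded functions $f:B\to\mathbb{N}$, where a solution to $f$ is an infinite $Y$ contained in the base of $B$ such that $f$ is injective on $B\vert Y$. $\mathsf{RT}^B_k$ is the problem whose instances are the functions $g:B\to k=\{0,\dots,k-1\}$, where a solution to $g$ is an infinite subset $H$ of the base of $B$ such that $g$ is constant on $B\vert H$. Instances and solutions are coded as subsets of $\mathbb{N}$ in a standard way, a coloring being given together with its domain (so that the barrier is uniformly computable from a coloring of it). For such problems $\mathsf{P},\mathsf{Q}$, $\mathsf{Q}\leq_{\mathrm{sW}}\mathsf{P}$ (strong Weihrauch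 reducibility) means: there are Turing functionals $\Phi,\Psi$ such that for every instance $I$ of $\mathsf{Q}$, $\Phi(I)$ is an instance of $\mathsf{P}$, and for every solution $\hat Y$ to $\Phi(I)$, $\Psi(\hat Y)$ is a solution to $I$ for $\mathsf{Q}$. *)

theory Defs
  imports "HOL-Library.Infinite_Set" "HOL-Library.Nat_Bijection"
begin

section \<open>Turing functionals\<close>

text \<open>
  Kleene's partial recursive functions relative to a set \<open>A\<close>. Programs are variadic: the
  argument list is supplied by the evaluation relation, and a program applied to a list of
  unsuitable length just has no value. Arguments of the step function of \<open>PrimRec\<close> are: value at
  \<open>n\<close>, then \<open>n\<close>, then the parameters.
\<close>

datatype orec = Zero | Succ | Proj nat | Query | Comp orec "orec list" | PrimRec orec orec | Mu orec

inductive orec_eval :: "nat set \<Rightarrow> orec \<Rightarrow> nat list \<Rightarrow> nat \<Rightarrow> bool" for A where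
  zero: "orec_eval A Zero xs 0"
| succ: "orec_eval A Succ [x] (Suc x)"
| proj: "i < length xs \<Longrightarrow> orec_eval A (Proj i) xs (xs ! i)"
| query: "orec_eval A Query [x] (if x \<in> A then 1 else 0)"
| comp: "list_all2 (\<lambda>g y. orec_eval A g xs y) gs ys \<Longrightarrow> orec_eval A f ys z
    \<Longrightarrow> orec_eval A (Comp f gs) xs z"
| prim_0: "orec_eval A f xs y \<Longrightarrow> orec_eval A (PrimRec f g) (0 # xs) y"
| prim_Suc: "orec_eval A (PrimRec f g) (n # xs) y \<Longrightarrow> orec_eval A g (y # n # xs) z
    \<Longrightarrow> orec_eval A (PrimRec f g) (Suc n # xs) z"
| mu: "orec_eval A f (n # xs) 0 \<Longrightarrow> \<forall>m<n. \<exists>y>0. orec_eval A f (m # xs) y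
    \<Longrightarrow> orec_eval A (Mu f) xs n"

lemma orec_eval_deterministic:
  "orec_eval A e xs y \<Longrightarrow> orec_eval A e xs z \<Longrightarrow> y = z"
proof (induction arbitrary: z rule: orec_eval.induct)
  case (zero xs)
  then show ?case by (auto elim: orec_eval.cases)
next
  case (succ x)
  then show ?case by (auto elim: orec_eval.cases)
next
  case (proj i xs)
  then show ?case by (auto elim: orec_eval.cases)
next
  case (query x)
  from query.prems show ?case by cases auto
next
  case (comp xs gs ys f z')
  from comp.prems obtain ys' where ys': "list_all2 (\<lambda>g y. orec_eval A g xs y) gs ys'"
    and z: "orec_eval A f ys' z" by cases auto
  have "ys = ys'"
  proof (rule nth_equalityI)
    show "length ys = length ys'"
      using list_all2_lengthD[OF comp.IH(1)] list_all2_lengthD[OF ys'] by simp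
    fix i assume i: "i < length ys"
    then have "orec_eval A (gs ! i) xs (ys' ! i)"
      using list_all2_nthD2[OF ys'] \<open>length ys = length ys'\<close> by simp
    then show "ys ! i = ys' ! i" using list_all2_nthD2[OF comp.IH(1) i] by blast
  qed
  then show ?case using comp.IH(2) z by blast
next
  case (prim_0 f xs y g)
  from prim_0.prems show ?case by cases (auto intro: prim_0.IH)
next
  case (prim_Suc f g n xs y w)
  from prim_Suc.prems obtain y' where y': "orec_eval A (PrimRec f g) (n # xs) y'"
    "orec_eval A g (y' # n # xs) z" by cases auto
  from prim_Suc.IH(1)[OF y'(1)] y'(2) show ?case by (auto intro: prim_Suc.IH(2))
next
  case (mu f n xs)
  from mu.prems have "orec_eval A f (z # xs) 0 \<and> (\<forall>m<z. \<exists>y>0. orec_eval A f (m # xs) y)"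
    by cases auto
  then have 1: "orec_eval A f (z # xs) 0"
    and 2: "\<forall>m<z. \<exists>y>0. orec_eval A f (m # xs) y" by auto
  show ?case
  proof (rule linorder_cases[of n z])
    assume "n < z"
    then obtain y where "y > 0" "orec_eval A f (n # xs) y" using 2 by blast
    then show ?thesis using mu.IH(1) by blast
  next
    assume "n = z" then show ?thesis .
  next
    assume "z < n"
    then obtain y where "y > 0" "\<forall>w. orec_eval A f (z # xs) w \<longrightarrow> y = w" using mu.IH(2) by blast
    then show ?thesis using 1 by blast
  qed
qed

text \<open>\<open>computes_set e A C\<close>: the Turing functional with program \<open>e\<close> is defined on \<open>A\<close>, with value \<open>C\<close>.\<close>

definition computes_set :: "orec \<Rightarrow> nat set \<Rightarrow> nat set \<Rightarrow> bool" where
  "computes_set e A C \<longleftrightarrow> (\<forall>n. orec_eval A e [n] (if n \<in> C then 1 else 0))"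

lemma computes_set_unique:
  assumes "computes_set e A C" "computes_set e A D"
  shows "C = D"
proof (rule set_eqI)
  fix n
  have "(if n \<in> C then 1 else 0) = (if n \<in> D then 1 else 0 :: nat)"
    using assms unfolding computes_set_def by (blast intro: orec_eval_deterministic)
  then show "n \<in> C \<longleftrightarrow> n \<in> D" by (simp split: if_splits)
qed

section \<open>Problems and strong Weihrauch reducibility\<close>

record problem =
  instances :: "nat set set"
  solutions :: "nat set \<Rightarrow> nat set set"

definition sW_reducible :: "problem \<Rightarrow> problem \<Rightarrow> bool" (infix "\<le>\<^sub>s\<^sub>W" 50) where
  "Q \<le>\<^sub>s\<^sub>W P \<longleftrightarrow> (\<exists>\<Phi> \<Psi>. \<forall>I \<in> instances Q. \<exists>J \<in> instances P. computes_set \<Phi> I J \<and>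
      (\<forall>Y \<in> solutions P J. \<exists>Z \<in> solutions Q I. computes_set \<Psi> Y Z))"

section \<open>Barriers\<close>

text \<open>
  Comparison of strictly increasing enumerations. Meant for infinite \<open>Y\<close>, in which case an initial
  segment \<open>s\<close> that is finite is automatically proper.
\<close>

definition init_seg :: "nat set \<Rightarrow> nat set \<Rightarrow> bool" where
  "init_seg s Y \<longleftrightarrow> finite s \<and> sorted_list_of_set s = map (enumerate Y) [0..<card s]"

definition barrier_on :: "nat set \<Rightarrow> nat set set \<Rightarrow> bool" where
  "barrier_on X B \<longleftrightarrow> infinite X \<and> (\<forall>s\<in>B. finite s) \<and> \<Union>B = X \<and>
     (\<forall>s\<in>B. \<forall>t\<in>B. \<not> s \<subset> t) \<and>
     (\<forall>Y. infinite Y \<and> Y \<subseteq> X \<longrightarrow> (\<exists>s\<in>B. init_seg s Y))"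

definition barrier :: "nat set set \<Rightarrow> bool" where
  "barrier B \<longleftrightarrow> (\<exists>X. barrier_on X B)"

definition restr :: "nat set set \<Rightarrow> nat set \<Rightarrow> nat set set" where
  "restr B Y = {s \<in> B. s \<subseteq> Y}"

section \<open>The Ramsey and rainbow Ramsey problems of a barrier\<close>

text \<open>
  The code of \<open>f : B \<rightarrow> \<nat>\<close> is the join of its domain \<open>B\<close> and its graph, finite sets being coded by
  their canonical indices. Only the values of \<open>f\<close> on \<open>B\<close> matter, and they are determined by the code.
\<close>

definition coloring_code :: "nat set set \<Rightarrow> (nat set \<Rightarrow> nat) \<Rightarrow> nat set" where
  "coloring_code B f =
     sum_encode ` ((set_encode ` B) <+> ((\<lambda>s. prod_encode (set_encode s, f s)) ` B))"

lemma coloring_code_inject: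
  assumes "\<forall>s\<in>B. finite s" "\<forall>s\<in>C. finite s"
  shows "coloring_code B f = coloring_code C g \<longleftrightarrow> B = C \<and> (\<forall>s\<in>B. f s = g s)"
proof
  assume "coloring_code B f = coloring_code C g"
  then have *: "(set_encode ` B) <+> ((\<lambda>s. prod_encode (set_encode s, f s)) ` B)
      = (set_encode ` C) <+> ((\<lambda>s. prod_encode (set_encode s, g s)) ` C)"
    unfolding coloring_code_def by (simp add: inj_image_eq_iff inj_sum_encode)
  have Plus: "U = U' \<and> V = V'" if "U <+> V = U' <+> V'" for U U' V V' :: "nat set"
  proof -
    have "Inl -` (U <+> V) = U" "Inl -` (U' <+> V') = U'"
      "Inr -` (U <+> V) = V" "Inr -` (U' <+> V') = V'" by auto
    with that show ?thesis by simp
  qed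
  have 1: "set_encode ` B = set_encode ` C"
    and 2: "(\<lambda>s. prod_encode (set_encode s, f s)) ` B = (\<lambda>s. prod_encode (set_encode s, g s)) ` C"
    using Plus[OF *] by auto
  have inj: "inj_on set_encode (Collect finite)" by (rule inj_on_set_encode)
  have BC: "B = C" using 1 inj_on_image_eq_iff[OF inj, of B C] assms by blast
  have "f s = g s" if s: "s \<in> B" for s
  proof -
    from s 2 obtain t where t: "t \<in> C" "prod_encode (set_encode s, f s) = prod_encode (set_encode t, g t)"
      by blast
    then have "set_encode s = set_encode t" "f s = g t" by auto
    moreover have "s = t" using calculation(1) s t(1) assms inj by (auto dest: inj_onD)
    ultimately show ?thesis by simp
  qed
  with BC show "B = C \<and> (\<forall>s\<in>B. f s = g s)" by blast
next
  assume "B = C \<and> (\<forall>s\<in>B. f s = g s)"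
  then show "coloring_code B f = coloring_code C g"
    unfolding coloring_code_def by (auto cong: image_cong)
qed

definition bounded_on :: "nat \<Rightarrow> nat set set \<Rightarrow> (nat set \<Rightarrow> nat) \<Rightarrow> bool" where
  "bounded_on k B f \<longleftrightarrow> (\<forall>x. finite {s \<in> B. f s = x} \<and> card {s \<in> B. f s = x} \<le> k)"

definition RRT :: "nat set set \<Rightarrow> nat \<Rightarrow> problem" where
  "RRT B k =
     \<lparr> instances = {coloring_code B f | f. bounded_on k B f},
       solutions = (\<lambda>I. {Y. infinite Y \<and> Y \<subseteq> \<Union>B \<and>
         (\<exists>f. I = coloring_code B f \<and> inj_on f (restr B Y))}) \<rparr>"

definition RT :: "nat set set \<Rightarrow> nat \<Rightarrow> problem" where
  "RT B k =
     \<lparr> instances = {coloring_code B g | g. g ` B \<subseteq> {..<k}},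
       solutions = (\<lambda>I. {H. infinite H \<and> H \<subseteq> \<Union>B \<and>
         (\<exists>g. I = coloring_code B g \<and> (\<exists>c. \<forall>s \<in> restr B H. g s = c))}) \<rparr>"

end

theory Submission imports Defs begin

text \<open>
  Given a \<open>k\<close>-bounded \<open>f\<close>, colour \<open>s \<in> B\<close> by its rank within the fibre of \<open>f\<close> through \<open>s\<close>, that is,
  by the number of \<open>t \<in> B\<close> with \<open>f t = f s\<close> and a smaller canonical index. The rank is below \<open>k\<close>,
  it is computable from \<open>f\<close>, and it separates the points of every fibre. Hence \<open>f\<close> is
  injective on every set on which the rank is constant, and \<open>\<Psi>\<close> can be the identity.
\<close>

section \<open>Uniformly computable functions\<close>

text \<open>One program has to serve every oracle in \<open>S\<close>, as a Turing functional must.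
  Restricting to \<open>S\<close> admits searches that halt only on oracles of a suitable
  form.\<close>

definition unif_computable :: "nat set set \<Rightarrow> nat \<Rightarrow> (nat set \<Rightarrow> nat list \<Rightarrow> nat) \<Rightarrow> bool" where
  "unif_computable S m F \<longleftrightarrow>
     (\<exists>e. \<forall>A\<in>S. \<forall>xs. length xs = m \<longrightarrow> orec_eval A e xs (F A xs))"

abbreviation unif_decidable :: "nat set set \<Rightarrow> nat \<Rightarrow> (nat set \<Rightarrow> nat list \<Rightarrow> bool) \<Rightarrow> bool" where
  "unif_decidable S m P \<equiv> unif_computable S m (\<lambda>A xs. of_bool (P A xs))"

section \<open>Projections, composition and primitive recursion\<close>

lemma unif_computable_cong:
  assumes "unif_computable S m F" "\<And>A xs. A \<in> S \<Longrightarrow> length xs = m \<Longrightarrow> F A xs = G A xs"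
  shows "unif_computable S m G"
  using assms unfolding unif_computable_def by metis

lemma unif_computable_nth: "i < m \<Longrightarrow> unif_computable S m (\<lambda>A xs. xs ! i)"
  unfolding unif_computable_def by (blast intro: orec_eval.proj)

lemma unif_computable_0: "unif_computable S m (\<lambda>A xs. 0)"
  unfolding unif_computable_def by (blast intro: orec_eval.zero)

lemma unif_computable_comp_list:
  assumes F: "unif_computable S (length Gs) F"
    and Gs: "\<forall>G\<in>set Gs. unif_computable S m G"
  shows "unif_computable S m (\<lambda>A xs. F A (map (\<lambda>G. G A xs) Gs))"
proof -
  obtain e where e: "orec_eval A e ys (F A ys)" if "A \<in> S" "length ys = length Gs" for A ys
    using F unfolding unif_computable_def by blast
  from Gs obtain p where p: "orec_eval A (p G) xs (G A xs)"
    if "G \<in> set Gs" "A \<in> S" "length xs = m" for G A xs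
    unfolding unif_computable_def by metis
  have "orec_eval A (Comp e (map p Gs)) xs (F A (map (\<lambda>G. G A xs) Gs))"
    if "A \<in> S" "length xs = m" for A xs
    by (rule orec_eval.comp[OF _ e]) (use that in \<open>auto simp: list_all2_conv_all_nth intro: p\<close>)
  then show ?thesis unfolding unif_computable_def by blast
qed

lemma unif_computable_comp:
  assumes "unif_computable S 1 (\<lambda>A xs. f A (xs ! 0))" "unif_computable S m G"
  shows "unif_computable S m (\<lambda>A xs. f A (G A xs))"
  using unif_computable_comp_list[of S "[G]" "\<lambda>A xs. f A (xs ! 0)" m] assms by simp

text \<open>Composing with the projections to the last \<open>m\<close> places adds \<open>d\<close>
  leading dummy arguments, so that values put in front by a recursion can be ignored.\<close>

lemma unif_computable_drop:
  assumes "unif_computable S m F"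
  shows "unif_computable S (d + m) (\<lambda>A xs. F A (drop d xs))"
proof -
  have nths: "map (\<lambda>G. G A xs) (map (\<lambda>i A xs. xs ! i) [d..<d + m]) = drop d xs"
    if "length xs = d + m" for A :: "nat set" and xs :: "nat list"
    using that by (auto intro!: nth_equalityI)
  have *: "unif_computable S (d + m)
      (\<lambda>A xs. F A (map (\<lambda>G. G A xs) (map (\<lambda>i A xs. xs ! i) [d..<d + m])))"
    by (rule unif_computable_comp_list) (use assms in \<open>auto intro: unif_computable_nth\<close>)
  show ?thesis by (rule unif_computable_cong[OF *]) (simp only: nths)
qed

lemma unif_computable_tl:
  "unif_computable S m F \<Longrightarrow> unif_computable S (Suc m) (\<lambda>A xs. F A (tl xs))"
  using unif_computable_drop[of S m F 1] by (simp add: drop_Suc)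

text \<open>\<open>PrimRec\<close> recurses on its first argument. Composing it with
  \<open>H\<close> followed by all projections makes the computed value \<open>H A xs\<close> the
  length of the recursion.\<close>

lemma unif_computable_rec_nat:
  assumes F: "unif_computable S m F" and H: "unif_computable S m H"
    and G: "unif_computable S (Suc (Suc m)) G"
  shows "unif_computable S m (\<lambda>A xs. rec_nat (F A xs) (\<lambda>n y. G A (y # n # xs)) (H A xs))"
proof -
  let ?R = "\<lambda>A xs. rec_nat (F A xs) (\<lambda>n y. G A (y # n # xs))"
  obtain f where f: "orec_eval A f xs (F A xs)" if "A \<in> S" "length xs = m" for A xs
    using F unfolding unif_computable_def by blast
  obtain g where g: "orec_eval A g ys (G A ys)" if "A \<in> S" "length ys = Suc (Suc m)" for A ys
    using G unfolding unif_computable_def by blast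
  have "orec_eval A (PrimRec f g) (n # xs) (?R A xs n)" if "A \<in> S" "length xs = m" for A xs n
  proof (induction n)
    case 0
    show ?case using f[OF that] by (simp add: orec_eval.prim_0)
  next
    case (Suc n)
    then show ?case using g that by (auto intro: orec_eval.prim_Suc)
  qed
  then have "unif_computable S (Suc m) (\<lambda>A xs. ?R A (tl xs) (hd xs))"
    unfolding unif_computable_def by (intro exI[of _ "PrimRec f g"]) (auto simp: length_Suc_conv)
  then have *: "unif_computable S m (\<lambda>A xs. (\<lambda>A xs. ?R A (tl xs) (hd xs)) A
      (map (\<lambda>G. G A xs) (H # map (\<lambda>i A xs. xs ! i) [0..<m])))"
    by (intro unif_computable_comp_list) (use H in \<open>auto intro: unif_computable_nth\<close>)
  have nths: "map (\<lambda>G. G A xs) (map (\<lambda>i A xs. xs ! i) [0..<m]) = xs"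
    if "length xs = m" for A :: "nat set" and xs :: "nat list"
    using that by (auto intro!: nth_equalityI)
  show ?thesis
    by (rule unif_computable_cong[OF *]) (simp only: list.map list.sel nths)
qed

section \<open>Arithmetic and case distinction\<close>

lemma unif_computable_Suc:
  assumes "unif_computable S m F"
  shows "unif_computable S m (\<lambda>A xs. Suc (F A xs))"
proof (rule unif_computable_comp[OF _ assms])
  have "orec_eval A Succ xs (Suc (xs ! 0))" if "length xs = 1" for A xs
    using that by (auto simp: length_Suc_conv intro: orec_eval.succ)
  then show "unif_computable S 1 (\<lambda>A xs. Suc (xs ! 0))"
    unfolding unif_computable_def by blast
qed

lemma unif_computable_add:
  assumes "unif_computable S m F" "unif_computable S m G"
  shows "unif_computable S m (\<lambda>A xs. F A xs + G A xs)"
proof -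
  have "rec_nat x (\<lambda>_. Suc) n = x + n" for x n :: nat by (induction n) auto
  then show ?thesis
    using unif_computable_rec_nat[OF assms unif_computable_Suc[OF unif_computable_nth[of 0]]] by simp
qed

lemma unif_computable_diff:
  assumes "unif_computable S m F" "unif_computable S m G"
  shows "unif_computable S m (\<lambda>A xs. F A xs - G A xs)"
proof -
  have pred: "rec_nat 0 (\<lambda>n _. n) x = x - 1" for x :: nat by (cases x) auto
  have "unif_computable S m (\<lambda>A xs. H A xs - 1)" if "unif_computable S m H" for m H
    using unif_computable_rec_nat[OF unif_computable_0 that unif_computable_nth[of 1]]
    by (simp add: pred)
  moreover have "rec_nat x (\<lambda>_ y. y - 1) n = x - n" for x n :: nat by (induction n) auto
  ultimately show ?thesis
    using unif_computable_rec_nat[OF assms, of "\<lambda>A ys. ys ! 0 - 1"]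
    by (simp add: unif_computable_nth)
qed

text \<open>A truth value is 0 or 1, so this is a recursion of that length: the base is the else
  branch, and a single step discards its two arguments and returns the other branch.\<close>

lemma unif_computable_If:
  assumes "unif_decidable S m P" "unif_computable S m F" "unif_computable S m G"
  shows "unif_computable S m (\<lambda>A xs. if P A xs then F A xs else G A xs)"
proof -
  have "rec_nat y (\<lambda>_ _. x) (of_bool p) = (if p then x else y)" for x y :: nat and p
    by simp
  then show ?thesis
    using unif_computable_rec_nat[OF assms(3,1) unif_computable_tl[OF unif_computable_tl[OF assms(2)]]]
    by simp
qed

section \<open>Decidable relations, bounded sums and quantifiers, search, pairing\<close>

lemma unif_decidable_not:
  assumes "unif_decidable S m P"
  shows "unif_decidable S m (\<lambda>A xs. \<not> P A xs)"
  by (rule unif_computable_cong[OF unif_computable_If[OF assms unif_computable_0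
          unif_computable_Suc[OF unif_computable_0]]]) auto

lemma unif_decidable_disj:
  assumes "unif_decidable S m P" "unif_decidable S m Q"
  shows "unif_decidable S m (\<lambda>A xs. P A xs \<or> Q A xs)"
  by (rule unif_computable_cong[OF unif_computable_If[OF assms(1)
          unif_computable_Suc[OF unif_computable_0] assms(2)]]) auto

lemma unif_decidable_conj:
  assumes "unif_decidable S m P" "unif_decidable S m Q"
  shows "unif_decidable S m (\<lambda>A xs. P A xs \<and> Q A xs)"
  by (rule unif_computable_cong[OF unif_computable_If[OF assms unif_computable_0]]) auto

lemma unif_decidable_eq_0:
  assumes "unif_computable S m F"
  shows "unif_decidable S m (\<lambda>A xs. F A xs = 0)"
proof -
  have "1 - x = of_bool (x = 0)" for x :: nat by auto
  then show ?thesis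
    using unif_computable_diff[OF unif_computable_Suc[OF unif_computable_0] assms] by simp
qed

text \<open>Both truncated differences vanish exactly when the values agree.\<close>

lemma unif_decidable_eq:
  assumes "unif_computable S m F" "unif_computable S m G"
  shows "unif_decidable S m (\<lambda>A xs. F A xs = G A xs)"
  by (rule unif_computable_cong[OF unif_decidable_eq_0[OF unif_computable_add[OF
            unif_computable_diff[OF assms] unif_computable_diff[OF assms(2,1)]]]]) auto

lemma unif_decidable_mem:
  assumes "unif_computable S m F"
  shows "unif_decidable S m (\<lambda>A xs. F A xs \<in> A)"
proof (rule unif_computable_comp[OF _ assms])
  have "orec_eval A Query xs (of_bool (xs ! 0 \<in> A))" if "length xs = 1" for A xs
    using that orec_eval.query[of A "xs ! 0"] by (auto simp: length_Suc_conv of_bool_def)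
  then show "unif_computable S 1 (\<lambda>A xs. of_bool (xs ! 0 \<in> A))"
    unfolding unif_computable_def by blast
qed

lemma unif_computable_sum:
  assumes H: "unif_computable S m H" and G: "unif_computable S (Suc m) G"
  shows "unif_computable S m (\<lambda>A xs. \<Sum>i<H A xs. G A (i # xs))"
proof -
  have "rec_nat 0 (\<lambda>n y. y + g n) n = (\<Sum>i<n. g i)" for g :: "nat \<Rightarrow> nat" and n
    by (induction n) auto
  then show ?thesis
    using unif_computable_rec_nat[OF unif_computable_0 H
        unif_computable_add[OF unif_computable_nth[of 0] unif_computable_tl[OF G]]]
    by simp
qed

text \<open>The sum of the truth values counts the witnesses below the bound.\<close>

lemma unif_decidable_bex:
  assumes "unif_computable S m H" "unif_decidable S (Suc m) P"
  shows "unif_decidable S m (\<lambda>A xs. \<exists>i<H A xs. P A (i # xs))"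
  by (rule unif_computable_cong[OF unif_decidable_not[OF unif_decidable_eq_0[OF
            unif_computable_sum[OF assms]]]]) auto

text \<open>\<open>Mu\<close> looks for a zero, so it is run on the negation of \<open>P\<close>;
  \<open>ex\<close> makes it halt, and minimality gives the positive values before.\<close>

lemma unif_computable_Least:
  assumes P: "unif_decidable S (Suc m) P"
    and ex: "\<And>A xs. A \<in> S \<Longrightarrow> length xs = m \<Longrightarrow> \<exists>n. P A (n # xs)"
  shows "unif_computable S m (\<lambda>A xs. LEAST n. P A (n # xs))"
proof -
  obtain e where "orec_eval A e ys (of_bool (\<not> P A ys))" if "A \<in> S" "length ys = Suc m" for A ys
    using unif_decidable_not[OF P] unfolding unif_computable_def by blast
  then have e: "orec_eval A e (n # xs) (of_bool (\<not> P A (n # xs)))"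
    if "A \<in> S" "length xs = m" for A n xs
    using that by simp
  have "orec_eval A (Mu e) xs (LEAST n. P A (n # xs))" if A: "A \<in> S" and xs: "length xs = m" for A xs
  proof (rule orec_eval.mu)
    have "P A ((LEAST n. P A (n # xs)) # xs)" using LeastI_ex[OF ex[OF A xs]] .
    then show "orec_eval A e ((LEAST n. P A (n # xs)) # xs) 0" using e[OF A xs, of "LEAST n. P A (n # xs)"] by simp
    show "\<forall>i<LEAST n. P A (n # xs). \<exists>y>0. orec_eval A e (i # xs) y"
    proof (intro allI impI)
      fix i assume "i < (LEAST n. P A (n # xs))"
      then have "\<not> P A (i # xs)" by (rule not_less_Least)
      then show "\<exists>y>0. orec_eval A e (i # xs) y" using e[OF A xs, of i] by auto
    qed
  qed
  then show ?thesis unfolding unif_computable_def by blast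
qed

text \<open>The Cantor pairing is \<open>triangle (a + b) + a\<close>, and triangular numbers are
  bounded sums.\<close>

lemma unif_computable_prod_encode:
  assumes "unif_computable S m F" "unif_computable S m G"
  shows "unif_computable S m (\<lambda>A xs. prod_encode (F A xs, G A xs))"
proof -
  have "(\<Sum>i<n. Suc i) = triangle n" for n by (induction n) auto
  then have "unif_computable S m (\<lambda>A xs. triangle (F A xs + G A xs))"
    using unif_computable_sum[OF unif_computable_add[OF assms]
        unif_computable_Suc[OF unif_computable_nth[of 0]]] by simp
  then show ?thesis
    using unif_computable_add[OF _ assms(1)] by (simp add: prod_encode_def)
qed

section \<open>The rank colouring\<close>

lemma even_mem_coloring_code: "2 * a \<in> coloring_code B f \<longleftrightarrow> a \<in> set_encode ` B"
proof -
  have *: "2 * a = sum_encode (Inl a)" by (simp add: sum_encode_def)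
  show ?thesis unfolding coloring_code_def * inj_image_mem_iff[OF inj_sum_encode] by auto
qed

lemma odd_mem_coloring_code:
  "Suc (2 * prod_encode (a, x)) \<in> coloring_code B f \<longleftrightarrow> (\<exists>s\<in>B. a = set_encode s \<and> x = f s)"
proof -
  have *: "Suc (2 * prod_encode (a, x)) = sum_encode (Inr (prod_encode (a, x)))"
    by (simp add: sum_encode_def)
  show ?thesis unfolding coloring_code_def * inj_image_mem_iff[OF inj_sum_encode] by auto
qed

text \<open>Here \<open>A\<close> is the code of a colouring and \<open>a\<close> the canonical index of a finite set. The disjunct
  \<open>2 * a \<notin> A\<close> makes the search end also on indices outside the domain.\<close>

definition decode_color :: "nat set \<Rightarrow> nat \<Rightarrow> nat" where
  "decode_color A a = (LEAST x. 2 * a \<notin> A \<or> Suc (2 * prod_encode (a, x)) \<in> A)"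

text \<open>Finding \<open>c\<close> paired with the colour in the graph tests at once that
  \<open>c\<close> indexes a member of the domain and that this member lies in the right
  fibre.\<close>

definition decode_rank :: "nat set \<Rightarrow> nat \<Rightarrow> nat" where
  "decode_rank A a = (\<Sum>c<a. of_bool (Suc (2 * prod_encode (c, decode_color A a)) \<in> A))"

definition fibre_rank :: "nat set set \<Rightarrow> (nat set \<Rightarrow> nat) \<Rightarrow> nat set \<Rightarrow> nat" where
  "fibre_rank B f s = card {t \<in> B. set_encode t < set_encode s \<and> f t = f s}"

lemma unif_computable_decode_color:
  assumes "\<And>A. A \<in> S \<Longrightarrow> \<exists>B f. A = coloring_code B f"
  shows "unif_computable S 1 (\<lambda>A xs. decode_color A (xs ! 0))"
proof -
  \<comment> \<open>Argument 0 is the candidate colour, argument 1 the index. Doubling is written as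
    a sum to match the closure under addition.\<close>
  let ?P = "\<lambda>A xs. xs ! 1 + xs ! 1 \<notin> A \<or>
    Suc (prod_encode (xs ! 1, xs ! 0) + prod_encode (xs ! 1, xs ! 0)) \<in> A"
  have "unif_computable S 1 (\<lambda>A xs. LEAST x. ?P A (x # xs))"
  proof (rule unif_computable_Least)
    show "unif_decidable S (Suc 1) ?P"
      by (intro unif_decidable_disj unif_decidable_not unif_decidable_mem unif_computable_Suc
          unif_computable_add unif_computable_prod_encode unif_computable_nth) auto
    fix A and xs :: "nat list"
    assume "A \<in> S"
    then obtain B f where A: "A = coloring_code B f" using assms by blast
    show "\<exists>x. ?P A (x # xs)"
      unfolding A mult_2[symmetric] even_mem_coloring_code odd_mem_coloring_code by auto
  qed
  then show ?thesis unfolding decode_color_def by (simp add: mult_2)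
qed

lemma unif_computable_decode_rank:
  assumes "\<And>A. A \<in> S \<Longrightarrow> \<exists>B f. A = coloring_code B f"
  shows "unif_computable S 1 (\<lambda>A xs. decode_rank A (xs ! 0))"
proof -
  let ?e = "\<lambda>A xs. prod_encode (xs ! 0, decode_color A (xs ! 1))"
  have "unif_decidable S (Suc 1) (\<lambda>A xs. Suc (?e A xs + ?e A xs) \<in> A)"
    by (intro unif_decidable_mem unif_computable_Suc unif_computable_add unif_computable_prod_encode
        unif_computable_comp[OF unif_computable_decode_color[OF assms]] unif_computable_nth) auto
  from unif_computable_sum[OF unif_computable_nth[of 0] this] show ?thesis
    unfolding decode_rank_def by (simp add: mult_2)
qed

text \<open>Since \<open>set_encode\<close> is injective on finite sets, the graph has just one
  entry at the index of \<open>s\<close>, and the search can stop only at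
  \<open>f s\<close>.\<close>

lemma decode_color_eq:
  assumes "\<forall>t\<in>B. finite t" "s \<in> B"
  shows "decode_color (coloring_code B f) (set_encode s) = f s"
proof -
  have "set_encode s = set_encode t \<longleftrightarrow> s = t" if "t \<in> B" for t
    using assms that by (simp add: set_encode_eq)
  then have "(\<exists>t\<in>B. set_encode s = set_encode t \<and> x = f t) \<longleftrightarrow> x = f s" for x
    using assms(2) by blast
  then show ?thesis
    using assms(2) unfolding decode_color_def even_mem_coloring_code odd_mem_coloring_code
    by (simp add: Least_equality)
qed

text \<open>The sum counts indices; injectivity of \<open>set_encode\<close> on finite sets turns
  this into a count of sets.\<close>

lemma decode_rank_eq:
  assumes fin: "\<forall>t\<in>B. finite t" and s: "s \<in> B"
  shows "decode_rank (coloring_code B f) (set_encode s) = fibre_rank B f s"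
proof -
  let ?T = "{t \<in> B. set_encode t < set_encode s \<and> f t = f s}"
  have "{..<set_encode s} \<inter> {c. \<exists>t\<in>B. c = set_encode t \<and> f s = f t} = set_encode ` ?T"
    by auto
  moreover have "inj_on set_encode ?T"
    by (rule inj_on_subset[OF inj_on_set_encode]) (use fin in auto)
  ultimately show ?thesis
    unfolding decode_rank_def fibre_rank_def decode_color_eq[OF assms] odd_mem_coloring_code
    by (simp add: sum_of_bool_eq card_image)
qed

text \<open>Describes the new code by \<open>A\<close> and \<open>n\<close> alone. The domain half
  is copied from \<open>A\<close>; the quantifiers can be bounded because neither component of a
  pair exceeds its code.\<close>

lemma mem_coloring_code_fibre_rank:
  assumes fin: "\<forall>t\<in>B. finite t" and A: "A = coloring_code B f"
  shows "n \<in> coloring_code B (fibre_rank B f) \<longleftrightarrow>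
    (\<exists>a<Suc n. n = 2 * a \<and> n \<in> A) \<or>
    (\<exists>a<Suc n. \<exists>b<Suc n. n = Suc (2 * prod_encode (a, b)) \<and> 2 * a \<in> A \<and> b = decode_rank A a)"
proof (cases "even n")
  case True
  then obtain a where n: "n = 2 * a" by blast
  have "n \<in> coloring_code B (fibre_rank B f) \<longleftrightarrow> n \<in> A"
    unfolding A n even_mem_coloring_code ..
  moreover have "(\<exists>a<Suc n. n = 2 * a \<and> n \<in> A) \<longleftrightarrow> n \<in> A" by (auto simp: n)
  moreover have "n \<noteq> Suc (2 * q)" for q using True by auto
  ultimately show ?thesis by simp
next
  case False
  then obtain p where "n = Suc (2 * p)" by (metis oddE Suc_eq_plus1)
  moreover obtain a b where p: "p = prod_encode (a, b)" by (metis prod_decode_inverse surj_pair)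
  moreover have "a \<le> p" "b \<le> p" unfolding p by (rule le_prod_encode_1 le_prod_encode_2)+
  ultimately have n: "n = Suc (2 * prod_encode (a, b))" "a < Suc n" "b < Suc n" by simp_all
  \<comment> \<open>\<open>decode_rank\<close> is known to be the rank only at indices of members of
    \<open>B\<close>, hence the membership test beside the equation.\<close>
  have "(\<exists>s\<in>B. a = set_encode s \<and> b = fibre_rank B f s) \<longleftrightarrow>
      a \<in> set_encode ` B \<and> b = decode_rank A a"
    by (auto simp: A decode_rank_eq[OF fin])
  then have "n \<in> coloring_code B (fibre_rank B f) \<longleftrightarrow> 2 * a \<in> A \<and> b = decode_rank A a"
    unfolding n(1) odd_mem_coloring_code unfolding A even_mem_coloring_code .
  moreover have "n = Suc (2 * prod_encode (a', b')) \<longleftrightarrow> a' = a \<and> b' = b" for a' b'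
    unfolding n(1) by auto
  then have "(\<exists>a'<Suc n. \<exists>b'<Suc n. n = Suc (2 * prod_encode (a', b')) \<and> 2 * a' \<in> A \<and>
      b' = decode_rank A a') \<longleftrightarrow> 2 * a \<in> A \<and> b = decode_rank A a"
    using n(2,3) by auto
  moreover have "n \<noteq> 2 * q" for q using False by auto
  ultimately show ?thesis by simp
qed

text \<open>Yields the forward functional: the program is fixed before \<open>f\<close>. The
  relation characterizing the new code is assembled from the innermost quantifier outwards.\<close>

lemma unif_computable_coloring_code_fibre_rank:
  assumes fin: "\<forall>t\<in>B. finite t"
  obtains e where "\<And>f. computes_set e (coloring_code B f) (coloring_code B (fibre_rank B f))"
proof -
  define S where "S = range (coloring_code B)"
  let ?e = "\<lambda>xs. prod_encode (xs ! 1, xs ! 0)"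
  have S: "\<exists>B f. A = coloring_code B f" if "A \<in> S" for A using that by (auto simp: S_def)
  have "unif_decidable S (Suc 1) (\<lambda>A xs. xs ! 1 = xs ! 0 + xs ! 0 \<and> xs ! 1 \<in> A)"
    by (intro unif_decidable_conj unif_decidable_eq unif_decidable_mem unif_computable_add
        unif_computable_nth) auto
  from unif_decidable_bex[OF unif_computable_Suc[OF unif_computable_nth[of 0]] this]
  have even: "unif_decidable S 1 (\<lambda>A xs. \<exists>a<Suc (xs ! 0). xs ! 0 = 2 * a \<and> xs ! 0 \<in> A)"
    by (simp add: mult_2)
  \<comment> \<open>Each quantifier prepends its variable, so the arguments here are
    \<open>b\<close>, \<open>a\<close>, \<open>n\<close> in this order.\<close>
  have "unif_decidable S (Suc 2) (\<lambda>A xs. xs ! 2 = Suc (?e xs + ?e xs) \<and>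
      xs ! 1 + xs ! 1 \<in> A \<and> xs ! 0 = decode_rank A (xs ! 1))"
    by (intro unif_decidable_conj unif_decidable_eq unif_decidable_mem unif_computable_add
        unif_computable_Suc unif_computable_prod_encode
        unif_computable_comp[OF unif_computable_decode_rank[OF S]] unif_computable_nth) auto
  from unif_decidable_bex[OF unif_computable_Suc[OF unif_computable_nth[of 1]] this]
  have "unif_decidable S (Suc 1) (\<lambda>A xs. \<exists>b<Suc (xs ! 1). xs ! 1 = Suc (2 * prod_encode (xs ! 0, b))
      \<and> 2 * xs ! 0 \<in> A \<and> b = decode_rank A (xs ! 0))"
    by (simp add: mult_2 numeral_2_eq_2)
  from unif_decidable_bex[OF unif_computable_Suc[OF unif_computable_nth[of 0]] this]
  have odd: "unif_decidable S 1 (\<lambda>A xs. \<exists>a<Suc (xs ! 0). \<exists>b<Suc (xs ! 0).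
      xs ! 0 = Suc (2 * prod_encode (a, b)) \<and> 2 * a \<in> A \<and> b = decode_rank A a)"
    by simp
  let ?P = "\<lambda>A n. (\<exists>a<Suc n. n = 2 * a \<and> n \<in> A) \<or>
    (\<exists>a<Suc n. \<exists>b<Suc n. n = Suc (2 * prod_encode (a, b)) \<and> 2 * a \<in> A \<and> b = decode_rank A a)"
  obtain e where *: "orec_eval A e xs (of_bool (?P A (xs ! 0)))" if "A \<in> S" "length xs = 1" for A xs
    using unif_decidable_disj[OF even odd] unfolding unif_computable_def by blast
  have e: "orec_eval A e [n] (of_bool (?P A n))" if "A \<in> S" for A n
    using *[OF that, of "[n]"] by simp
  have "computes_set e (coloring_code B f) (coloring_code B (fibre_rank B f))" for f
    unfolding computes_set_def mem_coloring_code_fibre_rank[OF fin refl]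
    using e[of "coloring_code B f"] by (simp add: S_def of_bool_def)
  then show thesis by (rule that)
qed

section \<open>Ranks are below the bound and separate each fibre\<close>

text \<open>\<open>s\<close> belongs to its fibre but does not precede itself, so the rank counts a
  proper subset of a set of size at most \<open>k\<close>.\<close>

lemma fibre_rank_less_bound:
  assumes "bounded_on k B f" "s \<in> B"
  shows "fibre_rank B f s < k"
proof -
  let ?T = "{t \<in> B. f t = f s}"
  have "finite ?T" "card ?T \<le> k" using assms(1) unfolding bounded_on_def by blast+
  moreover have "{t \<in> B. set_encode t < set_encode s \<and> f t = f s} \<subset> ?T" using assms(2) by blast
  ultimately show ?thesis unfolding fibre_rank_def
    by (meson order_less_le_trans psubset_card_mono)
qed

text \<open>\<open>s\<close> is counted in the rank of \<open>t\<close> but not in its own. As the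
  fibre is finite, the strict inclusion gives a strict inequality.\<close>

lemma fibre_rank_less:
  assumes "bounded_on k B f" "s \<in> B" "f s = f t" "set_encode s < set_encode t"
  shows "fibre_rank B f s < fibre_rank B f t"
  unfolding fibre_rank_def
proof (rule psubset_card_mono)
  have "finite {u \<in> B. f u = f t}" using assms(1) unfolding bounded_on_def by blast
  then show "finite {u \<in> B. set_encode u < set_encode t \<and> f u = f t}"
    by (rule rev_finite_subset) auto
  show "{u \<in> B. set_encode u < set_encode s \<and> f u = f s}
      \<subset> {u \<in> B. set_encode u < set_encode t \<and> f u = f t}"
    using assms by auto
qed

text \<open>Members of \<open>C\<close> with a common colour also share the rank, so neither index
  is smaller; finite sets with equal indices are equal.\<close>

lemma inj_on_fibre_rank_constant:
  assumes "bounded_on k B f" "\<forall>s\<in>B. finite s" "C \<subseteq> B" "\<And>s. s \<in> C \<Longrightarrow> fibre_rank B f s = c"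
  shows "inj_on f C"
proof (rule inj_onI)
  fix s t assume st: "s \<in> C" "t \<in> C" "f s = f t"
  then have "\<not> set_encode s < set_encode t" "\<not> set_encode t < set_encode s"
    using assms(3,4) fibre_rank_less[OF assms(1)] by (metis less_irrefl subsetD)+
  then show "s = t" using assms(2,3) st set_encode_eq by (metis linorder_neqE_nat subsetD)
qed

theorem proposition10:
  fixes k :: nat and B :: "nat set set"
  assumes "k > 0" and "barrier B"
  shows "RRT B k \<le>\<^sub>s\<^sub>W RT B k"
proof -
  have fin: "\<forall>s\<in>B. finite s" using assms(2) by (auto simp: barrier_def barrier_on_def)
  obtain \<Phi> where \<Phi>: "computes_set \<Phi> (coloring_code B f) (coloring_code B (fibre_rank B f))" for f
    using unif_computable_coloring_code_fibre_rank[OF fin] by blast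
  \<comment> \<open>A query returns the characteristic function of the oracle, so
    \<open>Query\<close> computes the identity.\<close>
  have \<Psi>: "computes_set Query Y Y" for Y
    unfolding computes_set_def by (simp add: orec_eval.query)
  show ?thesis unfolding sW_reducible_def
  proof (rule exI[of _ \<Phi>], rule exI[of _ Query], rule ballI)
    fix I assume "I \<in> instances (RRT B k)"
    then obtain f where I: "I = coloring_code B f" and f: "bounded_on k B f"
      by (auto simp: RRT_def)
    let ?J = "coloring_code B (fibre_rank B f)"
    have "Y \<in> solutions (RRT B k) I" if "Y \<in> solutions (RT B k) ?J" for Y
    proof -
      from that obtain g c where Y: "infinite Y" "Y \<subseteq> \<Union>B" and J: "?J = coloring_code B g"
        and c: "\<forall>s\<in>restr B Y. g s = c"
        by (auto simp: RT_def)
      \<comment> \<open>A solution mentions only some \<open>g\<close> with the same code. The code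
        determines the values on \<open>B\<close>, so the rank itself is constant on
        \<open>restr B Y\<close>.\<close>
      from J have "\<forall>s\<in>B. fibre_rank B f s = g s" using coloring_code_inject[OF fin fin] by blast
      then have "inj_on f (restr B Y)"
        using c by (intro inj_on_fibre_rank_constant[OF f fin]) (auto simp: restr_def)
      then show ?thesis using Y I by (auto simp: RRT_def)
    qed
    moreover have "?J \<in> instances (RT B k)"
      using fibre_rank_less_bound[OF f] by (auto simp: RT_def)
    ultimately show "\<exists>J\<in>instances (RT B k). computes_set \<Phi> I J \<and>
        (\<forall>Y\<in>solutions (RT B k) J. \<exists>Z\<in>solutions (RRT B k) I. computes_set Query Y Z)"
      using \<Phi> \<Psi> I by blast
  qed
qed

end
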